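(* Let $H$ be a separable Hilbert space, let $\{x_n\}_{n\in\mathbb{N}}$ be a frame-normalizable sequence of nonzero elements of $H$, and let $A>0$ be a lower frame bound for $\{x_n/\|x_n\|\}$. Let $\{y_n\}_{n\in\mathbb{N}}$ be a sequence of nonzero elements of $H$ satisfying at least one of the following conditions. (a) There exist $\lambda,\nu\in[0,1)$ such that for every $N\in\mathbb{N}$ and all scalars $c_1,\dots,c_N$, $$\Bigl\|\sum_{n=1}^N c_n(x_n-y_n)\Bigr\|\le \lambda\Bigl\|\sum_{n=1}^N c_nx_n\Bigr\|+\nu\Bigl\|\sum_{n=1}^N c_ny_n\Bigr\|.$$ (b) There exists $0\le K<\min\{1,\sqrt{A}\}$ such that for every $N\in\mathbb{N}$ and all scalars $c_1,\dots,c_N$, $$\Bigl\|\sum_{n=1}^N \frac{c_n}{\|x_n\|}(x_n-y_n)\Bigr\|\le K\Bigl(\sum_{n=1}^N|c_n|^2\Bigr)^{1/2}.$$ (c) There exists $0\le K<\frac{\sqrt{A}}{1+\sqrt{A}}$ such that for every $N\in\mathbb{N}$ and all scalars $c_1,\dots,c_N$, $$\Bigl\|\sum_{n=1}^N \frac{c_n}{\|y_n\|}(x_n-y_n)\Bigr\|\le K\Bigl(\sum_{n=1}^N|c_n|^2\Bigr)^{1/2}.$$ Then $\{y_n\}$ is a frame-normalizable sequence.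
   Context: A sequence $\{z_n\}$ in $H$ is a frame for $H$ if there are constants $0<A\le B$ with $A\|x\|^2\le\sum_n|\langle x,z_n\rangle|^2\le B\|x\|^2$ for all $x\in H$; such an $A$ is called a lower frame bound. A sequence $\{z_n\}$ of nonzero elements of $H$ is frame-normalizable if $\{z_n/\|z_n\|\}$ is a frame for $H$. *)

theory Defs
  imports "HOL-Analysis.Analysis"
begin

(* The scalar field. Since x + x* and x x* are real (expand x x* = |x|^2 at x + 1), every
   element is algebraic of degree at most 2 over the reals, so up to isomorphism the only
   members of this class are the real and the complex numbers with their usual conjugation. *)
class conj_normed_field = real_normed_field +
  fixes sconj :: "'a \<Rightarrow> 'a"
  assumes sconj_add: "sconj (a + b) = sconj a + sconj b"
    and sconj_mult: "sconj (a * b) = sconj a * sconj b"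
    and mult_sconj: "a * sconj a = (norm a)\<^sup>2 *\<^sub>R 1"

instantiation real :: conj_normed_field
begin
definition sconj_real :: "real \<Rightarrow> real" where "sconj_real a = a"
instance by standard (simp_all add: sconj_real_def power2_eq_square)
end

instantiation complex :: conj_normed_field
begin
definition sconj_complex :: "complex \<Rightarrow> complex" where "sconj_complex = cnj"
instance by standard (simp_all add: sconj_complex_def complex_norm_square scaleR_conv_of_real del: of_real_power)
end

(* A Hilbert space over the real or complex field 'k: a complete real normed space whose real
   scaling is the restriction of a scaling by 'k, and whose norm is induced by a 'k-valued inner
   product, linear in the first and conjugate-linear in the second argument. *)
locale hilbert_space = vector_space scale
  for scale :: "'k::conj_normed_field \<Rightarrow> 'v::banach \<Rightarrow> 'v" +
  fixes ip :: "'v \<Rightarrow> 'v \<Rightarrow> 'k"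
  assumes scale_of_real: "scale (of_real r) u = r *\<^sub>R u"
    and ip_add_left: "ip (u + v) w = ip u w + ip v w"
    and ip_scale_left: "ip (scale a u) w = a * ip u w"
    and ip_commute: "ip u v = sconj (ip v u)"
    and ip_self: "ip u u = of_real ((norm u)\<^sup>2)"

lemma hilbert_space_real:
  "hilbert_space scaleR (inner :: 'v::{real_inner, banach} \<Rightarrow> 'v \<Rightarrow> real)"
  by unfold_locales
    (simp_all add: algebra_simps sconj_real_def inner_commute power2_norm_eq_inner)

lemma hilbert_space_complex: "hilbert_space (*) (\<lambda>u v :: complex. u * cnj v)"
  by unfold_locales
    (simp_all add: algebra_simps sconj_complex_def complex_norm_square scaleR_conv_of_real
      del: of_real_power)

definition frame_bounds :: "('v::banach \<Rightarrow> 'v \<Rightarrow> 'k::conj_normed_field) \<Rightarrow> (nat \<Rightarrow> 'v) \<Rightarrow> real \<Rightarrow> real \<Rightarrow> bool"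
  where "frame_bounds ip z A B \<longleftrightarrow> 0 < A \<and> A \<le> B \<and>
    (\<forall>u. summable (\<lambda>n. (norm (ip u (z n)))\<^sup>2) \<and>
         A * (norm u)\<^sup>2 \<le> (\<Sum>n. (norm (ip u (z n)))\<^sup>2) \<and>
         (\<Sum>n. (norm (ip u (z n)))\<^sup>2) \<le> B * (norm u)\<^sup>2)"

definition is_frame :: "('v::banach \<Rightarrow> 'v \<Rightarrow> 'k::conj_normed_field) \<Rightarrow> (nat \<Rightarrow> 'v) \<Rightarrow> bool"
  where "is_frame ip z \<longleftrightarrow> (\<exists>A B. frame_bounds ip z A B)"

definition lower_frame_bound :: "('v::banach \<Rightarrow> 'v \<Rightarrow> 'k::conj_normed_field) \<Rightarrow> (nat \<Rightarrow> 'v) \<Rightarrow> real \<Rightarrow> bool"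
  where "lower_frame_bound ip z A \<longleftrightarrow> (\<exists>B. frame_bounds ip z A B)"

definition frame_normalizable :: "('v::banach \<Rightarrow> 'v \<Rightarrow> 'k::conj_normed_field) \<Rightarrow> (nat \<Rightarrow> 'v) \<Rightarrow> bool"
  where "frame_normalizable ip z \<longleftrightarrow>
    (\<forall>n. z n \<noteq> 0) \<and> is_frame ip (\<lambda>n. z n /\<^sub>R norm (z n))"

end

theory Submission
  imports Defs
begin

text \<open>
  Conditions (b) and (c) bound the \<open>\<ell>\<^sup>2\<close> distance between the analysis operators of a frame and its
  perturbation, so there the triangle inequality in \<open>\<ell>\<^sup>2\<close> suffices, once the ratios
  \<open>norm (y n) / norm (x n)\<close> are seen to be bounded above and away from \<open>0\<close>.

  Under (a), put \<open>f = x / norm x\<close> and \<open>g = y / norm x\<close>. Writing \<open>F\<close>, \<open>G\<close> for sums of \<open>f\<close>, \<open>g\<close> with the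
  same coefficients and \<open>m < 1\<close> for the larger of the two constants, every point
  \<open>Z = F - t (F - G)\<close> of the segment from \<open>F\<close> to \<open>G\<close> satisfies
  \<open>norm (F - G) \<le> 2 m / (1 - m) * norm Z\<close>. Hence \<open>f\<close> is joined to \<open>g\<close> by finitely many
  perturbations that are small relative to the synthesis operator. Each of them preserves the
  property that every vector can be approximated by finite combinations whose coefficients are
  controlled in \<open>\<ell>\<^sup>2\<close>, which is dual to the lower frame inequality.
\<close>

section \<open>Conjugation and absolute value of scalars\<close>

lemma sconj_zero [simp]: "sconj (0 :: 'k::conj_normed_field) = 0"
  using sconj_add[of "0::'k" 0] by simp

lemma norm_sconj [simp]: "norm (sconj a) = norm (a :: 'k::conj_normed_field)"
proof (cases "a = 0")
  case False
  have "norm a * norm (sconj a) = norm a * norm a"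
    using arg_cong[OF mult_sconj[of a], of norm] by (simp add: norm_mult power2_eq_square)
  with False show ?thesis by simp
qed simp

text \<open>That conjugation fixes the reals is not an axiom of the class. It follows from
  \<open>mult_sconj\<close>, since the squared norm of a real scalar is its square and one factor
  cancels.\<close>

lemma sconj_of_real [simp]: "sconj (of_real r) = (of_real r :: 'k::conj_normed_field)"
proof (cases "r = 0")
  case False
  have "of_real r * sconj (of_real r) = (of_real r * of_real r :: 'k)"
    using mult_sconj[of "of_real r :: 'k"]
    by (simp add: power2_eq_square scaleR_conv_of_real)
  with False show ?thesis by simp
qed simp

lemma mult_sconj_of_real: "a * sconj a = (of_real ((norm a)\<^sup>2) :: 'k::conj_normed_field)"
  by (simp add: mult_sconj scaleR_conv_of_real)

section \<open>Inner product algebra and the Cauchy-Schwarz inequality\<close>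

context hilbert_space
begin

lemma ip_add_right: "ip u (v + w) = ip u v + ip u w"
  by (metis ip_add_left ip_commute sconj_add)

lemma ip_scale_right: "ip u (scale a v) = sconj a * ip u v"
  by (metis ip_commute ip_scale_left sconj_mult)

lemma norm_ip_commute: "norm (ip u v) = norm (ip v u)"
  by (metis ip_commute norm_sconj)

lemma ip_mult_commute: "ip u v * ip v u = of_real ((norm (ip u v))\<^sup>2)"
  by (metis ip_commute mult_sconj_of_real)

lemma ip_zero_left [simp]: "ip 0 v = 0"
  using ip_add_left[of 0 0 v] by simp

lemma ip_sum_left: "ip (\<Sum>i\<in>I. h i) v = (\<Sum>i\<in>I. ip (h i) v)"
  by (induction I rule: infinite_finite_induct) (auto simp: ip_add_left)

lemma ip_scaleR_left: "ip (r *\<^sub>R u) v = of_real r * ip u v"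
  by (metis ip_scale_left scale_of_real)

lemma ip_scaleR_right: "ip u (r *\<^sub>R v) = of_real r * ip u v"
  by (metis ip_scale_right scale_of_real sconj_of_real)

lemma ip_diff_left: "ip (u - v) w = ip u w - ip v w"
  by (metis add_diff_cancel diff_add_cancel ip_add_left)

lemma ip_diff_right: "ip u (v - w) = ip u v - ip u w"
  by (metis add_diff_cancel diff_add_cancel ip_add_right)

lemma scale_scaleR: "scale c (r *\<^sub>R v) = r *\<^sub>R scale c v"
  by (metis scale_left_commute scale_of_real)

lemma scale_divide_of_real: "scale (c / of_real r) v = scale c (v /\<^sub>R r)"
  by (metis divide_inverse of_real_inverse scale_of_real scale_scale)

text \<open>The norm is known a priori to be homogeneous for real factors; for factors in
  \<open>'k\<close> this comes from \<open>ip_self\<close>.\<close>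

lemma norm_scale: "norm (scale a v) = norm a * norm v"
proof -
  have "(of_real ((norm (scale a v))\<^sup>2) :: 'k) = a * sconj a * ip v v"
    by (simp only: ip_self[symmetric] ip_scale_left ip_scale_right ac_simps)
  also have "\<dots> = of_real ((norm a * norm v)\<^sup>2)"
    by (simp only: mult_sconj_of_real ip_self of_real_mult[symmetric] power_mult_distrib)
  finally have "(norm (scale a v))\<^sup>2 = (norm a * norm v)\<^sup>2"
    by (simp only: of_real_eq_iff)
  then show ?thesis by simp
qed

text \<open>When the cross term is real, both mixed products coincide and the expansion is a real
  quadratic in \<open>r\<close>. It serves the Cauchy-Schwarz inequality and the contraction
  estimate for the frame operator.\<close>

lemma norm_diff_scaleR_sq:
  assumes "ip w v = of_real p"
  shows "(norm (v - r *\<^sub>R w))\<^sup>2 = (norm v)\<^sup>2 - 2 * r * p + r\<^sup>2 * (norm w)\<^sup>2"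
proof -
  have "ip v w = of_real p"
    using assms by (metis ip_commute sconj_of_real)
  note vw = this assms
  have "(of_real ((norm (v - r *\<^sub>R w))\<^sup>2) :: 'k) = ip (v - r *\<^sub>R w) (v - r *\<^sub>R w)"
    by (simp only: ip_self)
  also have "\<dots> = ip v v - 2 * of_real r * of_real p + (of_real r)\<^sup>2 * ip w w"
    by (simp add: ip_diff_left ip_diff_right ip_scaleR_left ip_scaleR_right vw
        power2_eq_square algebra_simps)
  also have "\<dots> = of_real ((norm v)\<^sup>2 - 2 * r * p + r\<^sup>2 * (norm w)\<^sup>2)"
    by (simp add: ip_self)
  finally show ?thesis by (simp only: of_real_eq_iff)
qed

lemma norm_ip_le: "norm (ip u v) \<le> norm u * norm v"
proof (cases "v = 0")
  case True
  then show ?thesis using norm_ip_commute[of u v] by simp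
next
  case False
  define p where "p = (norm (ip u v))\<^sup>2"
  \<comment> \<open>The factor \<open>ip u v\<close> makes the product with \<open>u\<close> real.
    For \<open>r = 1 / (norm v)\<^sup>2\<close>, the vector \<open>r *\<^sub>R w\<close> is the
    orthogonal projection of \<open>u\<close> onto the line through \<open>v\<close>.\<close>
  define w where "w = scale (ip u v) v"
  have "ip w u = of_real p"
    by (simp only: w_def p_def ip_scale_left ip_mult_commute)
  from norm_diff_scaleR_sq[OF this, of "1 / (norm v)\<^sup>2"]
  have "0 \<le> (norm u)\<^sup>2 - 2 * (1 / (norm v)\<^sup>2) * p + (1 / (norm v)\<^sup>2)\<^sup>2 * (norm w)\<^sup>2"
    by (metis zero_le_power2)
  also have "(norm w)\<^sup>2 = p * (norm v)\<^sup>2"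
    by (simp add: w_def p_def norm_scale power_mult_distrib)
  finally have "p \<le> (norm u * norm v)\<^sup>2"
    using False by (simp add: field_simps power2_eq_square)
  then show ?thesis
    unfolding p_def by (rule power2_le_imp_le) simp
qed

section \<open>Bessel sequences: synthesis and analysis bounds\<close>

text \<open>This bounds the synthesis operator on finite sequences, so no operator on an infinite
  sequence space has to be built. The usual Bessel bound is the square of \<open>b\<close>.\<close>

definition bessel :: "(nat \<Rightarrow> 'v) \<Rightarrow> real \<Rightarrow> bool"
  where "bessel z b \<longleftrightarrow> 0 \<le> b \<and>
    (\<forall>N c. norm (\<Sum>n<N. scale (c n) (z n)) \<le> b * L2_set (\<lambda>n. norm (c n)) {..<N})"

lemma bessel_norm_le:
  assumes "bessel z b"
  shows "norm (z n) \<le> b"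
proof -
  define c :: "nat \<Rightarrow> 'k" where "c = (\<lambda>i. if i = n then 1 else 0)"
  have "(\<Sum>i<Suc n. scale (c i) (z i)) = (\<Sum>i<Suc n. if i = n then z i else 0)"
    by (rule sum.cong) (auto simp: c_def)
  moreover have "(\<Sum>i<Suc n. (norm (c i))\<^sup>2) = (\<Sum>i<Suc n. if i = n then 1 else 0)"
    by (rule sum.cong) (auto simp: c_def)
  moreover have "norm (\<Sum>i<Suc n. scale (c i) (z i)) \<le> b * L2_set (\<lambda>i. norm (c i)) {..<Suc n}"
    using assms unfolding bessel_def by blast
  ultimately show ?thesis by (simp add: L2_set_def)
qed

text \<open>The analysis operator is the adjoint of the synthesis operator. Synthesizing the
  analysis coefficients of \<open>u\<close> themselves gives
  \<open>P\<^sup>2 = norm (ip w u) \<le> b * P * norm u\<close>, and one factor \<open>P\<close>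
  cancels.\<close>

lemma bessel_imp_analysis:
  assumes "bessel z b"
  shows "L2_set (\<lambda>n. norm (ip u (z n))) {..<N} \<le> b * norm u"
proof -
  define P where "P = L2_set (\<lambda>n. norm (ip u (z n))) {..<N}"
  define w where "w = (\<Sum>n<N. scale (ip u (z n)) (z n))"
  have b: "0 \<le> b" "norm w \<le> b * P"
    using assms unfolding bessel_def w_def P_def by auto
  have P: "0 \<le> P" "P\<^sup>2 = (\<Sum>n<N. (norm (ip u (z n)))\<^sup>2)"
    by (auto simp: P_def L2_set_def sum_nonneg)
  have "ip w u = of_real (P\<^sup>2)"
    unfolding w_def P ip_sum_left ip_scale_left ip_mult_commute by simp
  then have "P\<^sup>2 = norm (ip w u)"
    by (simp only: norm_of_real abs_power2)
  also have "\<dots> \<le> norm w * norm u" by (rule norm_ip_le)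
  also have "norm w * norm u \<le> (b * P) * norm u"
    by (rule mult_right_mono) (use b in auto)
  finally have "P * P \<le> (b * norm u) * P"
    by (simp add: power2_eq_square algebra_simps)
  then have "P \<le> b * norm u"
    using P b by (cases "P = 0") (auto dest: mult_right_le_imp_le)
  then show ?thesis by (simp add: P_def)
qed

lemma norm_ip_sum_le:
  "norm (ip (\<Sum>n<N. scale (c n) (z n)) u)
    \<le> L2_set (\<lambda>n. norm (c n)) {..<N} * L2_set (\<lambda>n. norm (ip u (z n))) {..<N}"
proof -
  have "norm (ip (\<Sum>n<N. scale (c n) (z n)) u) \<le> (\<Sum>n<N. norm (c n) * norm (ip u (z n)))"
    unfolding ip_sum_left ip_scale_left
    by (rule sum_norm_le) (simp add: norm_mult norm_ip_commute)
  also have "\<dots> \<le> L2_set (\<lambda>n. norm (c n)) {..<N} * L2_set (\<lambda>n. norm (ip u (z n))) {..<N}"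
    using L2_set_mult_ineq[of "\<lambda>n. norm (c n)" "\<lambda>n. norm (ip u (z n))" "{..<N}"] by simp
  finally show ?thesis .
qed

text \<open>The dual direction: a synthesis sum \<open>w\<close> is tested against itself, and one
  factor \<open>norm w\<close> cancels.\<close>

lemma besselI_analysis:
  assumes b: "0 \<le> b" and an: "\<And>N u. L2_set (\<lambda>n. norm (ip u (z n))) {..<N} \<le> b * norm u"
  shows "bessel z b"
  unfolding bessel_def
proof (intro conjI allI)
  fix N and c :: "nat \<Rightarrow> 'k"
  define L where "L = L2_set (\<lambda>n. norm (c n)) {..<N}"
  define w where "w = (\<Sum>n<N. scale (c n) (z n))"
  have L: "0 \<le> L" by (simp add: L_def)
  have "(norm w)\<^sup>2 = norm (ip w w)"
    by (simp add: ip_self del: of_real_power)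
  also have "\<dots> \<le> L * L2_set (\<lambda>n. norm (ip w (z n))) {..<N}"
    using norm_ip_sum_le[of c z N w] by (simp add: w_def L_def)
  also have "\<dots> \<le> L * (b * norm w)"
    by (rule mult_left_mono[OF an L])
  finally have "norm w * norm w \<le> (b * L) * norm w"
    by (simp add: power2_eq_square algebra_simps)
  then have "norm w \<le> b * L"
    using b L by (cases "norm w = 0") (auto dest: mult_right_le_imp_le)
  then show "norm (\<Sum>n<N. scale (c n) (z n)) \<le> b * L2_set (\<lambda>n. norm (c n)) {..<N}"
    by (simp add: w_def L_def)
qed (rule b)

lemma frame_imp_bessel:
  assumes "frame_bounds ip z A B"
  shows "bessel z (sqrt B)"
proof (rule besselI_analysis)
  show "0 \<le> sqrt B" using assms by (auto simp: frame_bounds_def)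
  fix N u
  have "(\<Sum>n<N. (norm (ip u (z n)))\<^sup>2) \<le> (\<Sum>n. (norm (ip u (z n)))\<^sup>2)"
    using assms by (intro sum_le_suminf) (auto simp: frame_bounds_def)
  also have "\<dots> \<le> B * (norm u)\<^sup>2"
    using assms by (auto simp: frame_bounds_def)
  finally have "sqrt (\<Sum>n<N. (norm (ip u (z n)))\<^sup>2) \<le> sqrt (B * (norm u)\<^sup>2)"
    by simp
  then show "L2_set (\<lambda>n. norm (ip u (z n))) {..<N} \<le> sqrt B * norm u"
    by (simp add: L2_set_def real_sqrt_mult)
qed

lemma bessel_suminf:
  assumes "bessel z b"
  shows "summable (\<lambda>n. (norm (ip u (z n)))\<^sup>2)"
    and "(\<Sum>n. (norm (ip u (z n)))\<^sup>2) \<le> b\<^sup>2 * (norm u)\<^sup>2"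
proof -
  have part: "(\<Sum>n<N. (norm (ip u (z n)))\<^sup>2) \<le> b\<^sup>2 * (norm u)\<^sup>2" for N
    using sqrt_le_D[OF bessel_imp_analysis[OF assms, of u N, unfolded L2_set_def]]
    by (simp add: power_mult_distrib)
  show s: "summable (\<lambda>n. (norm (ip u (z n)))\<^sup>2)"
    by (rule summableI_nonneg_bounded[OF _ part]) simp
  show "(\<Sum>n. (norm (ip u (z n)))\<^sup>2) \<le> b\<^sup>2 * (norm u)\<^sup>2"
    by (rule suminf_le_const[OF s part])
qed

lemma L2_set_le_sqrt_suminf:
  assumes "bessel z b"
  shows "L2_set (\<lambda>n. norm (ip u (z n))) {..<N} \<le> sqrt (\<Sum>n. (norm (ip u (z n)))\<^sup>2)"
  unfolding L2_set_def
  by (intro real_sqrt_le_mono sum_le_suminf bessel_suminf[OF assms]) auto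

section \<open>Frame criterion and rescaling\<close>

lemma is_frameI:
  assumes "bessel z b" and "0 < a"
    and "\<And>u. a * norm u \<le> sqrt (\<Sum>n. (norm (ip u (z n)))\<^sup>2)"
  shows "is_frame ip z"
proof -
  have "a\<^sup>2 * (norm u)\<^sup>2 \<le> (\<Sum>n. (norm (ip u (z n)))\<^sup>2)" for u
  proof -
    have "(a * norm u)\<^sup>2 \<le> (sqrt (\<Sum>n. (norm (ip u (z n)))\<^sup>2))\<^sup>2"
      using assms by (intro power_mono) auto
    also have "\<dots> = (\<Sum>n. (norm (ip u (z n)))\<^sup>2)"
      by (rule real_sqrt_pow2, rule suminf_nonneg[OF bessel_suminf(1)[OF assms(1)]]) simp
    finally show ?thesis by (simp add: power_mult_distrib)
  qed
  \<comment> \<open>The maximum secures the order of the two bounds; in the zero space the estimates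
    do not imply \<open>a \<le> b\<close>.\<close>
  moreover have "(\<Sum>n. (norm (ip u (z n)))\<^sup>2) \<le> max (a\<^sup>2) (b\<^sup>2) * (norm u)\<^sup>2" for u
    using bessel_suminf(2)[OF assms(1), of u]
    by (rule order_trans) (simp add: mult_right_mono)
  ultimately have "frame_bounds ip z (a\<^sup>2) (max (a\<^sup>2) (b\<^sup>2))"
    using assms bessel_suminf(1)[OF assms(1)] by (auto simp: frame_bounds_def)
  then show ?thesis unfolding is_frame_def by blast
qed

text \<open>Each term of the frame sum is multiplied by \<open>(r n)\<^sup>2\<close>, which lies
  between \<open>a\<^sup>2\<close> and \<open>b\<^sup>2\<close>.\<close>

lemma frame_bounds_rescale:
  assumes fr: "frame_bounds ip z A B" and a: "0 < a" and r: "\<And>n. a \<le> r n" "\<And>n. r n \<le> b"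
  shows "frame_bounds ip (\<lambda>n. r n *\<^sub>R z n) (a\<^sup>2 * A) (b\<^sup>2 * B)"
proof -
  have fr': "0 < A" "A \<le> B" "\<And>u. summable (\<lambda>n. (norm (ip u (z n)))\<^sup>2)"
    "\<And>u. A * (norm u)\<^sup>2 \<le> (\<Sum>n. (norm (ip u (z n)))\<^sup>2)"
    "\<And>u. (\<Sum>n. (norm (ip u (z n)))\<^sup>2) \<le> B * (norm u)\<^sup>2"
    using fr by (auto simp: frame_bounds_def)
  have ab: "a \<le> b" using r[of 0] by linarith
  have eq: "(norm (ip u (r n *\<^sub>R z n)))\<^sup>2 = (r n)\<^sup>2 * (norm (ip u (z n)))\<^sup>2" for u n
    by (simp add: ip_scaleR_right norm_mult power_mult_distrib)
  have ra: "a\<^sup>2 \<le> (r n)\<^sup>2" and rb: "(r n)\<^sup>2 \<le> b\<^sup>2" for n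
    using r[of n] a by (auto intro!: power_mono)
  have s: "summable (\<lambda>n. (r n)\<^sup>2 * (norm (ip u (z n)))\<^sup>2)" for u
    by (rule summable_comparison_test'[OF summable_mult[OF fr'(3), of "b\<^sup>2" u], of 0])
      (simp add: mult_right_mono rb)
  have "a\<^sup>2 * A * (norm u)\<^sup>2 \<le> (\<Sum>n. (r n)\<^sup>2 * (norm (ip u (z n)))\<^sup>2)" for u
  proof -
    have "a\<^sup>2 * (A * (norm u)\<^sup>2) \<le> a\<^sup>2 * (\<Sum>n. (norm (ip u (z n)))\<^sup>2)"
      by (rule mult_left_mono[OF fr'(4)]) simp
    also have "\<dots> = (\<Sum>n. a\<^sup>2 * (norm (ip u (z n)))\<^sup>2)"
      by (rule suminf_mult[OF fr'(3), symmetric])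
    also have "\<dots> \<le> (\<Sum>n. (r n)\<^sup>2 * (norm (ip u (z n)))\<^sup>2)"
      by (intro suminf_le s summable_mult fr'(3) mult_right_mono ra) auto
    finally show ?thesis by (simp add: mult.assoc)
  qed
  moreover have "(\<Sum>n. (r n)\<^sup>2 * (norm (ip u (z n)))\<^sup>2) \<le> b\<^sup>2 * B * (norm u)\<^sup>2" for u
  proof -
    have "(\<Sum>n. (r n)\<^sup>2 * (norm (ip u (z n)))\<^sup>2) \<le> (\<Sum>n. b\<^sup>2 * (norm (ip u (z n)))\<^sup>2)"
      by (intro suminf_le s summable_mult fr'(3) mult_right_mono rb) auto
    also have "\<dots> = b\<^sup>2 * (\<Sum>n. (norm (ip u (z n)))\<^sup>2)"
      by (rule suminf_mult[OF fr'(3)])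
    also have "\<dots> \<le> b\<^sup>2 * (B * (norm u)\<^sup>2)"
      by (rule mult_left_mono[OF fr'(5)]) simp
    finally show ?thesis by (simp add: mult.assoc)
  qed
  moreover have "a\<^sup>2 * A \<le> b\<^sup>2 * B"
    using a ab fr' by (intro mult_mono power_mono) auto
  ultimately show ?thesis
    using a fr' s by (simp add: frame_bounds_def eq)
qed

text \<open>Under (a) and (b) the perturbed frame appears divided by \<open>norm (x n)\<close>; this
  exchanges that factor for the comparable \<open>norm (y n)\<close>.\<close>

lemma is_frame_renormalize:
  assumes "is_frame ip (\<lambda>n. y n /\<^sub>R s n)" and "0 < a"
    and "\<And>n. 0 < s n" and "\<And>n. y n \<noteq> 0"
    and "\<And>n. a * norm (y n) \<le> s n" and "\<And>n. s n \<le> b * norm (y n)"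
  shows "is_frame ip (\<lambda>n. y n /\<^sub>R norm (y n))"
proof -
  obtain A B where fr: "frame_bounds ip (\<lambda>n. y n /\<^sub>R s n) A B"
    using assms(1) by (auto simp: is_frame_def)
  have "(\<lambda>n. (s n / norm (y n)) *\<^sub>R (y n /\<^sub>R s n)) = (\<lambda>n. y n /\<^sub>R norm (y n))"
    using assms(3) by (auto simp: fun_eq_iff divide_inverse less_imp_neq[symmetric])
  moreover have "frame_bounds ip (\<lambda>n. (s n / norm (y n)) *\<^sub>R (y n /\<^sub>R s n)) (a\<^sup>2 * A) (b\<^sup>2 * B)"
    using assms by (intro frame_bounds_rescale[OF fr]) (auto simp: field_simps)
  ultimately show ?thesis by (auto simp: is_frame_def)
qed

section \<open>Perturbations small for the analysis operator\<close>

text \<open>The analysis sequences of \<open>u\<close> under \<open>f\<close> and \<open>g\<close>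
  differ by at most \<open>K * norm u\<close> in l2. Hence the square roots of the bounds move by at
  most \<open>K\<close>, and \<open>sqrt A - K\<close> is still positive.\<close>

lemma frame_perturb_analysis:
  assumes fr: "frame_bounds ip f A B" and K: "K < sqrt A" and d: "bessel (\<lambda>n. f n - g n) K"
  shows "is_frame ip g"
proof -
  have f: "bessel f (sqrt B)" by (rule frame_imp_bessel[OF fr])
  have K0: "0 \<le> K" and B0: "0 \<le> sqrt B" using d f by (auto simp: bessel_def)
  have tri: "norm (ip u (g n)) \<le> norm (ip u (f n)) + norm (ip u (f n - g n))"
    "norm (ip u (f n)) \<le> norm (ip u (g n)) + norm (ip u (f n - g n))" for u n
    using norm_triangle_sub[of "ip u (g n)" "ip u (f n)"] norm_triangle_sub[of "ip u (f n)" "ip u (g n)"]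
    by (simp_all add: ip_diff_right norm_minus_commute)
  have g: "bessel g (sqrt B + K)"
  proof (rule besselI_analysis)
    fix N u
    have "L2_set (\<lambda>n. norm (ip u (g n))) {..<N}
        \<le> L2_set (\<lambda>n. norm (ip u (f n)) + norm (ip u (f n - g n))) {..<N}"
      by (intro L2_set_mono) (simp_all add: tri)
    also have "\<dots> \<le> L2_set (\<lambda>n. norm (ip u (f n))) {..<N}
        + L2_set (\<lambda>n. norm (ip u (f n - g n))) {..<N}"
      by (rule L2_set_triangle_ineq)
    also have "\<dots> \<le> sqrt B * norm u + K * norm u"
      by (intro add_mono bessel_imp_analysis f d)
    finally show "L2_set (\<lambda>n. norm (ip u (g n))) {..<N} \<le> (sqrt B + K) * norm u"
      by (simp add: algebra_simps)
  qed (use K0 B0 in simp)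
  show ?thesis
  proof (rule is_frameI[OF g])
    show "0 < sqrt A - K" using K by simp
    fix u
    define G where "G = sqrt (\<Sum>n. (norm (ip u (g n)))\<^sup>2)"
    \<comment> \<open>The triangle inequality is applied to finite sections; the part from
      \<open>g\<close> is bounded by its whole series, so that \<open>N\<close> can tend to
      infinity.\<close>
    have "(\<Sum>n<N. (norm (ip u (f n)))\<^sup>2) \<le> (G + K * norm u)\<^sup>2" for N
    proof -
      have "L2_set (\<lambda>n. norm (ip u (f n))) {..<N}
          \<le> L2_set (\<lambda>n. norm (ip u (g n)) + norm (ip u (f n - g n))) {..<N}"
        by (intro L2_set_mono) (simp_all add: tri)
      also have "\<dots> \<le> L2_set (\<lambda>n. norm (ip u (g n))) {..<N}
          + L2_set (\<lambda>n. norm (ip u (f n - g n))) {..<N}"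
        by (rule L2_set_triangle_ineq)
      also have "\<dots> \<le> G + K * norm u"
        unfolding G_def by (intro add_mono bessel_imp_analysis d L2_set_le_sqrt_suminf[OF g])
      finally show ?thesis
        unfolding L2_set_def by (rule sqrt_le_D)
    qed
    then have "(\<Sum>n. (norm (ip u (f n)))\<^sup>2) \<le> (G + K * norm u)\<^sup>2"
      by (intro suminf_le_const bessel_suminf(1)[OF f])
    moreover have "A * (norm u)\<^sup>2 \<le> (\<Sum>n. (norm (ip u (f n)))\<^sup>2)"
      using fr by (simp add: frame_bounds_def)
    ultimately have "sqrt (A * (norm u)\<^sup>2) \<le> sqrt ((G + K * norm u)\<^sup>2)"
      by (intro real_sqrt_le_mono) linarith
    moreover have "0 \<le> G + K * norm u"
      using K0 suminf_nonneg[OF bessel_suminf(1)[OF g, of u]] by (simp add: G_def)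
    ultimately show "(sqrt A - K) * norm u \<le> sqrt (\<Sum>n. (norm (ip u (g n)))\<^sup>2)"
      by (simp add: real_sqrt_mult G_def[symmetric] algebra_simps)
  qed
qed

section \<open>Approximation with l2-controlled coefficients\<close>

text \<open>A quantitative form of surjectivity of the synthesis operator, stated with finite sums.
  The essential point is that \<open>K\<close> depends on neither \<open>v\<close> nor
  \<open>e\<close>.\<close>

definition approximating :: "(nat \<Rightarrow> 'v) \<Rightarrow> real \<Rightarrow> bool"
  where "approximating z K \<longleftrightarrow> (\<forall>v. \<forall>e>0. \<exists>N c.
    norm (v - (\<Sum>n<N. scale (c n) (z n))) \<le> e \<and> L2_set (\<lambda>n. norm (c n)) {..<N} \<le> K * norm v)"

text \<open>Padding with zeros brings two combinations to a common length so that they can be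
  added.\<close>

lemma extend_coefficients:
  fixes N M :: nat
  assumes "N \<le> M"
  obtains c' where "(\<Sum>n<M. scale (c' n) (z n)) = (\<Sum>n<N. scale (c n) (z n))"
    and "L2_set (\<lambda>n. norm (c' n)) {..<M} = L2_set (\<lambda>n. norm (c n)) {..<N}"
proof
  define c' where "c' = (\<lambda>n. if n < N then c n else 0)"
  show "(\<Sum>n<M. scale (c' n) (z n)) = (\<Sum>n<N. scale (c n) (z n))"
    by (rule sum.mono_neutral_cong_right) (use assms in \<open>auto simp: c'_def\<close>)
  show "L2_set (\<lambda>n. norm (c' n)) {..<M} = L2_set (\<lambda>n. norm (c n)) {..<N}"
    unfolding L2_set_def
    by (rule arg_cong[of _ _ sqrt], rule sum.mono_neutral_cong_right)
      (use assms in \<open>auto simp: c'_def\<close>)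
qed

text \<open>As in the proof of the open mapping theorem, a crude approximation is applied again to
  each residual. Residuals decay like \<open>q ^ k\<close>, and the coefficient norms add up to at
  most a geometric series.\<close>

lemma approximating_iterate:
  assumes q: "0 \<le> q" "q < 1" and K: "0 \<le> K"
    and step: "\<And>v. \<exists>N c. norm (v - (\<Sum>n<N. scale (c n) (z n))) \<le> q * norm v
      \<and> L2_set (\<lambda>n. norm (c n)) {..<N} \<le> K * norm v"
  shows "approximating z (K / (1 - q))"
  unfolding approximating_def
proof (intro allI impI)
  fix v and e :: real
  assume e: "0 < e"
  have it: "\<exists>N c. norm (v - (\<Sum>n<N. scale (c n) (z n))) \<le> q ^ k * norm v
      \<and> L2_set (\<lambda>n. norm (c n)) {..<N} \<le> K * (\<Sum>i<k. q ^ i) * norm v" for k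
  proof (induction k)
    case 0
    show ?case by (intro exI[of _ 0]) simp
  next
    case (Suc k)
    then obtain N c where c: "norm (v - (\<Sum>n<N. scale (c n) (z n))) \<le> q ^ k * norm v"
      "L2_set (\<lambda>n. norm (c n)) {..<N} \<le> K * (\<Sum>i<k. q ^ i) * norm v" by blast
    define w where "w = v - (\<Sum>n<N. scale (c n) (z n))"
    obtain M d where d: "norm (w - (\<Sum>n<M. scale (d n) (z n))) \<le> q * norm w"
      "L2_set (\<lambda>n. norm (d n)) {..<M} \<le> K * norm w" using step by blast
    obtain c' where c': "(\<Sum>n<max N M. scale (c' n) (z n)) = (\<Sum>n<N. scale (c n) (z n))"
      "L2_set (\<lambda>n. norm (c' n)) {..<max N M} = L2_set (\<lambda>n. norm (c n)) {..<N}"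
      using extend_coefficients[of N "max N M" z c] by auto
    obtain d' where d': "(\<Sum>n<max N M. scale (d' n) (z n)) = (\<Sum>n<M. scale (d n) (z n))"
      "L2_set (\<lambda>n. norm (d' n)) {..<max N M} = L2_set (\<lambda>n. norm (d n)) {..<M}"
      using extend_coefficients[of M "max N M" z d] by auto
    have w: "norm w \<le> q ^ k * norm v" using c by (simp add: w_def)
    have "v - (\<Sum>n<max N M. scale (c' n + d' n) (z n)) = w - (\<Sum>n<M. scale (d n) (z n))"
      by (simp add: scale_left_distrib sum.distrib c' d' w_def)
    moreover have "q * norm w \<le> q ^ Suc k * norm v"
      using mult_left_mono[OF w q(1)] by (simp add: mult.assoc)
    moreover have "L2_set (\<lambda>n. norm (c' n + d' n)) {..<max N M}
        \<le> L2_set (\<lambda>n. norm (c' n) + norm (d' n)) {..<max N M}"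
      by (intro L2_set_mono) (auto simp: norm_triangle_ineq)
    moreover have "\<dots> \<le> L2_set (\<lambda>n. norm (c' n)) {..<max N M} + L2_set (\<lambda>n. norm (d' n)) {..<max N M}"
      by (rule L2_set_triangle_ineq)
    moreover have "K * norm w \<le> K * q ^ k * norm v"
      using mult_left_mono[OF w K] by (simp add: mult.assoc)
    moreover have "K * (\<Sum>i<Suc k. q ^ i) * norm v
        = K * (\<Sum>i<k. q ^ i) * norm v + K * q ^ k * norm v"
      by (simp add: algebra_simps)
    ultimately show ?case
      using c d c' d'
      by (intro exI[of _ "max N M"] exI[of _ "\<lambda>n. c' n + d' n"]) (smt (verit))
  qed
  have "(\<lambda>k. q ^ k * norm v) \<longlonglongrightarrow> 0"
    using q by (intro tendsto_mult_left_zero LIMSEQ_realpow_zero) auto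
  then have "\<forall>\<^sub>F k in sequentially. q ^ k * norm v < e"
    using e by (rule order_tendstoD(2))
  then obtain k where k: "q ^ k * norm v < e"
    by (auto simp: eventually_sequentially)
  obtain N c where c: "norm (v - (\<Sum>n<N. scale (c n) (z n))) \<le> q ^ k * norm v"
    "L2_set (\<lambda>n. norm (c n)) {..<N} \<le> K * (\<Sum>i<k. q ^ i) * norm v" using it by blast
  \<comment> \<open>The number \<open>k\<close> of rounds depends on \<open>e\<close>; bounding the
    partial sum by the full series removes this dependence from the constant.\<close>
  have "(\<Sum>i<k. q ^ i) \<le> 1 / (1 - q)"
    using q by (simp add: sum_gp_strict divide_right_mono)
  then have "K * (\<Sum>i<k. q ^ i) * norm v \<le> K * (1 / (1 - q)) * norm v"
    using K by (intro mult_right_mono mult_left_mono) auto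
  then show "\<exists>N c. norm (v - (\<Sum>n<N. scale (c n) (z n))) \<le> e
      \<and> L2_set (\<lambda>n. norm (c n)) {..<N} \<le> K / (1 - q) * norm v"
    using c k by (intro exI[of _ N] exI[of _ c]) auto
qed

text \<open>One step of the Richardson iteration \<open>v \<mapsto> v - S v / B\<close> for the frame operator \<open>S\<close>, truncated so
  that half of the frame energy is captured, contracts by the factor \<open>sqrt (1 - A / (2 * B))\<close>.\<close>

lemma frame_imp_approximating:
  assumes fr: "frame_bounds ip z A B"
  shows "\<exists>K\<ge>0. approximating z K"
proof -
  have A: "0 < A" "A \<le> B" using fr by (auto simp: frame_bounds_def)
  have bs: "bessel z (sqrt B)" by (rule frame_imp_bessel[OF fr])
  define q where "q = sqrt (1 - A / (2 * B))"
  have q: "0 \<le> q" "q < 1" "q\<^sup>2 = 1 - A / (2 * B)"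
    using A by (auto simp: q_def field_simps)
  have "approximating z ((sqrt B / B) / (1 - q))"
  proof (rule approximating_iterate[OF q(1,2)])
    show "0 \<le> sqrt B / B" using A by simp
    fix v
    define P where "P N = (\<Sum>n<N. (norm (ip v (z n)))\<^sup>2)" for N
    \<comment> \<open>If every partial sum stayed below half of the lower bound, so would the
      series, forcing \<open>v = 0\<close>; but then the bound is met trivially.\<close>
    have "\<exists>N. A / 2 * (norm v)\<^sup>2 \<le> P N"
    proof (rule ccontr)
      assume "\<not> ?thesis"
      then have "P N \<le> A / 2 * (norm v)\<^sup>2" for N
        by (meson le_cases)
      then have "(\<Sum>n. (norm (ip v (z n)))\<^sup>2) \<le> A / 2 * (norm v)\<^sup>2"
        unfolding P_def by (intro suminf_le_const bessel_suminf(1)[OF bs])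
      moreover have "A * (norm v)\<^sup>2 \<le> (\<Sum>n. (norm (ip v (z n)))\<^sup>2)"
        using fr by (simp add: frame_bounds_def)
      ultimately have "A * (norm v)\<^sup>2 \<le> 0" by linarith
      then have "v = 0" using A by (simp add: mult_le_0_iff)
      with \<open>\<not> ?thesis\<close> show False by (auto simp: P_def sum_nonneg)
    qed
    then obtain N where N: "A / 2 * (norm v)\<^sup>2 \<le> P N" by blast
    define w where "w = (\<Sum>n<N. scale (ip v (z n)) (z n))"
    have L: "L2_set (\<lambda>n. norm (ip v (z n))) {..<N} = sqrt (P N)"
      by (simp add: L2_set_def P_def)
    have P0: "0 \<le> P N" by (simp add: P_def sum_nonneg)
    have "norm w \<le> sqrt B * sqrt (P N)"
      unfolding w_def L[symmetric]
      by (rule bs[unfolded bessel_def, THEN conjunct2, rule_format])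
    then have w2: "(norm w)\<^sup>2 \<le> B * P N"
      using power_mono[of "norm w" "sqrt B * sqrt (P N)" 2] A P0
      by (simp add: power_mult_distrib)
    have "ip w v = of_real (P N)"
      unfolding w_def P_def ip_sum_left ip_scale_left ip_mult_commute by simp
    \<comment> \<open>With step size \<open>1 / B\<close>, the Bessel estimate makes the quadratic
      term at most half of the linear one, so a decrease of at least \<open>P N / B\<close>
      remains.\<close>
    from norm_diff_scaleR_sq[OF this, of "1 / B"]
    have "(norm (v - (1 / B) *\<^sub>R w))\<^sup>2 = (norm v)\<^sup>2 - 2 * (1 / B) * P N + (1 / B)\<^sup>2 * (norm w)\<^sup>2" .
    also have "\<dots> \<le> (norm v)\<^sup>2 - 2 * (1 / B) * P N + (1 / B)\<^sup>2 * (B * P N)"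
      using w2 by (intro add_left_mono mult_left_mono) auto
    also have "\<dots> = (norm v)\<^sup>2 - P N / B"
      using A by (simp add: field_simps power2_eq_square)
    also have "\<dots> \<le> (norm v)\<^sup>2 - (A / 2 * (norm v)\<^sup>2) / B"
      using N A by (intro diff_left_mono divide_right_mono) auto
    also have "\<dots> = (q * norm v)\<^sup>2"
      by (simp add: power_mult_distrib q(3) algebra_simps)
    finally have 1: "norm (v - (1 / B) *\<^sub>R w) \<le> q * norm v"
      by (rule power2_le_imp_le) (simp add: q)
    have 2: "(\<Sum>n<N. scale (ip v (z n) / of_real B) (z n)) = (1 / B) *\<^sub>R w"
      by (simp add: w_def scale_divide_of_real scale_scaleR scaleR_sum_right inverse_eq_divide)
    have "L2_set (\<lambda>n. norm (ip v (z n) / of_real B)) {..<N}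
        = L2_set (\<lambda>n. norm (ip v (z n)) * (1 / B)) {..<N}"
      using A by (simp add: norm_divide)
    also have "\<dots> = L2_set (\<lambda>n. norm (ip v (z n))) {..<N} * (1 / B)"
      using A by (intro L2_set_left_distrib[symmetric]) simp
    also have "\<dots> \<le> (sqrt B * norm v) * (1 / B)"
      using A by (intro mult_right_mono bessel_imp_analysis[OF bs]) auto
    finally have 3: "L2_set (\<lambda>n. norm (ip v (z n) / of_real B)) {..<N} \<le> sqrt B / B * norm v"
      by simp
    show "\<exists>N c. norm (v - (\<Sum>n<N. scale (c n) (z n))) \<le> q * norm v
        \<and> L2_set (\<lambda>n. norm (c n)) {..<N} \<le> sqrt B / B * norm v"
      using 1 2 3 by (intro exI[of _ N] exI[of _ "\<lambda>n. ip v (z n) / of_real B"]) simp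
  qed
  moreover have "0 \<le> (sqrt B / B) / (1 - q)" using A q by simp
  ultimately show ?thesis by blast
qed

text \<open>Coefficients that approximate \<open>v\<close> by a sum \<open>F\<close> over
  \<open>f\<close> are reused for \<open>g\<close>. The new error is at most about
  \<open>q * norm F\<close>, hence a fixed fraction of \<open>norm v\<close>, and iteration removes
  it.\<close>

lemma approximating_perturb:
  assumes f: "approximating f K" "0 \<le> K" and q: "0 \<le> q" "q < 1"
    and d: "\<And>N c. norm (\<Sum>n<N. scale (c n) (f n - g n)) \<le> q * norm (\<Sum>n<N. scale (c n) (f n))"
  shows "\<exists>K'\<ge>0. approximating g K'"
proof -
  \<comment> \<open>The midpoint of \<open>q\<close> and \<open>1\<close> leaves room for two errors
    \<open>e = (1 - q) / 4 * norm v\<close>.\<close>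
  define p where "p = (1 + q) / 2"
  have p: "0 \<le> p" "p < 1" using q by (auto simp: p_def)
  have "approximating g (K / (1 - p))"
  proof (rule approximating_iterate[OF p f(2)])
    fix v
    show "\<exists>N c. norm (v - (\<Sum>n<N. scale (c n) (g n))) \<le> p * norm v
        \<and> L2_set (\<lambda>n. norm (c n)) {..<N} \<le> K * norm v"
    proof (cases "v = 0")
      case True
      then show ?thesis by (intro exI[of _ 0]) simp
    next
      case False
      define e where "e = (1 - q) / 4 * norm v"
      have "0 < e" using False q by (simp add: e_def)
      then obtain N c where c: "norm (v - (\<Sum>n<N. scale (c n) (f n))) \<le> e"
        "L2_set (\<lambda>n. norm (c n)) {..<N} \<le> K * norm v"
        using f(1) unfolding approximating_def by blast
      define F where "F = (\<Sum>n<N. scale (c n) (f n))"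
      define G where "G = (\<Sum>n<N. scale (c n) (g n))"
      have "norm (F - G) \<le> q * norm F"
        using d[of c N] by (simp add: F_def G_def scale_right_diff_distrib sum_subtractf)
      also have "\<dots> \<le> q * (norm v + e)"
        using c(1) norm_triangle_sub[of F v] q(1)
        by (intro mult_left_mono) (auto simp: F_def[symmetric] norm_minus_commute)
      also have "\<dots> \<le> q * norm v + e"
        using q \<open>0 < e\<close> by (simp add: algebra_simps mult_le_cancel_right1)
      finally have "norm (v - G) \<le> e + (q * norm v + e)"
        using c(1) norm_triangle_ineq[of "v - F" "F - G"] by (simp add: F_def[symmetric])
      also have "\<dots> = p * norm v" by (simp add: e_def p_def field_simps)
      finally show ?thesis using c(2) unfolding G_def by blast
    qed
  qed
  moreover have "0 \<le> K / (1 - p)" using f(2) p by simp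
  ultimately show ?thesis by blast
qed

text \<open>In \<open>ip u u\<close> the first argument is replaced by an approximating combination
  \<open>w\<close>. Cauchy-Schwarz in l2 bounds \<open>ip w u\<close> by \<open>K * norm u\<close>
  times the analysis norm; then \<open>norm u\<close> cancels and \<open>e\<close> tends to
  0.\<close>

lemma approximating_lower_bound:
  assumes z: "approximating z K" "bessel z b"
  shows "norm u \<le> K * sqrt (\<Sum>n. (norm (ip u (z n)))\<^sup>2)"
proof (cases "u = 0")
  case False
  define S where "S = sqrt (\<Sum>n. (norm (ip u (z n)))\<^sup>2)"
  have S0: "0 \<le> S"
    using suminf_nonneg[OF bessel_suminf(1)[OF z(2), of u]] by (simp add: S_def)
  have "norm u \<le> K * S + e" if e: "0 < e" for e
  proof -
    obtain N c where c: "norm (u - (\<Sum>n<N. scale (c n) (z n))) \<le> e"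
      "L2_set (\<lambda>n. norm (c n)) {..<N} \<le> K * norm u"
      using z(1) e unfolding approximating_def by blast
    define w where "w = (\<Sum>n<N. scale (c n) (z n))"
    have "norm u * norm u = norm (ip w u + ip (u - w) u)"
      by (simp add: ip_add_left[symmetric] ip_self norm_mult power2_eq_square)
    also have "\<dots> \<le> norm (ip w u) + norm (u - w) * norm u"
      by (rule norm_triangle_le) (simp add: norm_ip_le)
    also have "norm (ip w u) \<le> L2_set (\<lambda>n. norm (c n)) {..<N}
        * L2_set (\<lambda>n. norm (ip u (z n))) {..<N}"
      unfolding w_def by (rule norm_ip_sum_le)
    also have "\<dots> \<le> (K * norm u) * S"
      using L2_set_le_sqrt_suminf[OF z(2), of u N] c(2) order_trans[OF L2_set_nonneg c(2)]
      by (intro mult_mono) (auto simp: S_def)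
    also have "norm (u - w) * norm u \<le> e * norm u"
      using c(1) by (intro mult_right_mono) (auto simp: w_def)
    finally have "norm u * norm u \<le> (K * S + e) * norm u"
      by (simp add: algebra_simps)
    then show ?thesis using False by simp
  qed
  then show ?thesis unfolding S_def[symmetric] by (rule field_le_epsilon)
next
  case True
  then show ?thesis by simp
qed

section \<open>Perturbations small relative to the synthesis operator\<close>

lemma frame_perturb_synthesis:
  assumes fr: "is_frame ip f" and m: "0 \<le> m" "m < 1"
    and d: "\<And>N c. norm (\<Sum>n<N. scale (c n) (f n - g n))
      \<le> m * (norm (\<Sum>n<N. scale (c n) (f n)) + norm (\<Sum>n<N. scale (c n) (g n)))"
  shows "is_frame ip g"
proof -
  obtain A B where fb: "frame_bounds ip f A B" using fr by (auto simp: is_frame_def)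
  have bf: "bessel f (sqrt B)" by (rule frame_imp_bessel[OF fb])
  \<comment> \<open>The constant results from \<open>norm G \<le> norm F + norm (F - G)\<close>
    after absorbing \<open>m * norm G\<close> on the left. It transfers the Bessel property from
    \<open>f\<close> to \<open>g\<close>.\<close>
  define C where "C = (1 + m) / (1 - m)"
  have C0: "0 \<le> C" using m by (simp add: C_def)
  have gf: "norm (\<Sum>n<N. scale (c n) (g n)) \<le> C * norm (\<Sum>n<N. scale (c n) (f n))" for N c
  proof -
    define F where "F = (\<Sum>n<N. scale (c n) (f n))"
    define G where "G = (\<Sum>n<N. scale (c n) (g n))"
    have "norm (F - G) \<le> m * (norm F + norm G)"
      using d[of c N] by (simp add: F_def G_def scale_right_diff_distrib sum_subtractf)
    then have "(1 - m) * norm G \<le> (1 + m) * norm F"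
      using norm_triangle_ineq2[of G F] by (simp add: algebra_simps norm_minus_commute)
    then show ?thesis
      using m unfolding F_def[symmetric] G_def[symmetric] by (simp add: C_def field_simps)
  qed
  have bg: "bessel g (C * sqrt B)"
    unfolding bessel_def mult.assoc
    using bf C0 by (auto simp: bessel_def intro!: order_trans[OF gf] mult_left_mono)
  define D where "D = 2 * m / (1 - m)"
  have D0: "0 \<le> D" using m by (simp add: D_def)
  \<comment> \<open>With more than \<open>D\<close> equal steps along the segment, each step has
    relative size \<open>D / k < 1\<close>.\<close>
  obtain k :: nat where k: "D < real k" using reals_Archimedean2 by blast
  then have k0: "0 < k" using D0 by (cases k) auto
  define h where "h j n = f n - (real j / real k) *\<^sub>R (f n - g n)" for j n
  have "\<exists>K\<ge>0. approximating (h j) K" if "j \<le> k" for j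
    using that
  proof (induction j)
    case 0
    then show ?case using frame_imp_approximating[OF fb] by (simp add: h_def[abs_def])
  next
    case (Suc j)
    then obtain K where K: "0 \<le> K" "approximating (h j) K" by auto
    show ?case
    proof (rule approximating_perturb[OF K(2,1), of "D / real k"])
      show "0 \<le> D / real k" "D / real k < 1" using D0 k k0 by auto
      fix N and c :: "nat \<Rightarrow> 'k"
      define F where "F = (\<Sum>n<N. scale (c n) (f n))"
      define G where "G = (\<Sum>n<N. scale (c n) (g n))"
      define t where "t = real j / real k"
      define Z where "Z = (\<Sum>n<N. scale (c n) (h j n))"
      have t: "0 \<le> t" "t \<le> 1" using Suc.prems k0 by (auto simp: t_def)
      have FG: "(\<Sum>n<N. scale (c n) (f n - g n)) = F - G"
        by (simp add: F_def G_def scale_right_diff_distrib sum_subtractf)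
      have Z: "Z = F - t *\<^sub>R (F - G)"
        unfolding FG[symmetric]
        by (simp add: Z_def h_def F_def t_def scale_right_diff_distrib[of _ "f _" "_ *\<^sub>R _"]
            sum_subtractf scale_scaleR scaleR_sum_right)
      \<comment> \<open>The distances from \<open>Z\<close> to \<open>F\<close> and to
        \<open>G\<close> are \<open>t\<close> and \<open>1 - t\<close> times
        \<open>norm (F - G)\<close>, so they add up to \<open>norm (F - G)\<close> itself. Absorbing
        \<open>m * norm (F - G)\<close> then yields a constant \<open>D\<close> independent of
        \<open>t\<close>.\<close>
      have "norm F \<le> norm Z + t * norm (F - G)"
        using norm_triangle_ineq[of Z "t *\<^sub>R (F - G)"] t by (simp add: Z)
      moreover have "G = Z - (1 - t) *\<^sub>R (F - G)"
        by (simp add: Z algebra_simps)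
      then have "norm G \<le> norm Z + (1 - t) * norm (F - G)"
        using norm_triangle_ineq4[of Z "(1 - t) *\<^sub>R (F - G)"] t by simp
      ultimately have "norm F + norm G \<le> 2 * norm Z + norm (F - G)"
        by (simp add: algebra_simps)
      then have "m * (norm F + norm G) \<le> m * (2 * norm Z + norm (F - G))"
        by (rule mult_left_mono[OF _ m(1)])
      then have "norm (F - G) \<le> m * (2 * norm Z + norm (F - G))"
        using d[of c N] unfolding FG F_def[symmetric] G_def[symmetric] by linarith
      then have "norm (F - G) \<le> D * norm Z"
        using m by (simp add: D_def field_simps)
      moreover have "h j n - h (Suc j) n = (1 / real k) *\<^sub>R (f n - g n)" for n
        by (simp add: h_def add_divide_distrib algebra_simps)
      then have "(\<Sum>n<N. scale (c n) (h j n - h (Suc j) n)) = (1 / real k) *\<^sub>R (F - G)"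
        by (simp add: FG[symmetric] scale_scaleR scaleR_sum_right)
      ultimately show "norm (\<Sum>n<N. scale (c n) (h j n - h (Suc j) n))
          \<le> D / real k * norm (\<Sum>n<N. scale (c n) (h j n))"
        using k0 unfolding Z_def[symmetric] by (simp add: divide_right_mono)
    qed
  qed
  from this[of k] obtain K where K: "0 \<le> K" "approximating g K"
    using k0 by (auto simp: h_def[abs_def])
  show ?thesis
  proof (rule is_frameI[OF bg])
    \<comment> \<open>Adding 1 avoids division by zero, since \<open>K = 0\<close> is
      allowed.\<close>
    show "0 < 1 / (K + 1)" using K by simp
    fix u
    define S where "S = sqrt (\<Sum>n. (norm (ip u (g n)))\<^sup>2)"
    have "0 \<le> S"
      using suminf_nonneg[OF bessel_suminf(1)[OF bg, of u]] by (simp add: S_def)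
    moreover have "norm u \<le> K * S"
      unfolding S_def by (rule approximating_lower_bound[OF K(2) bg])
    ultimately show "1 / (K + 1) * norm u \<le> sqrt (\<Sum>n. (norm (ip u (g n)))\<^sup>2)"
      using K unfolding S_def[symmetric] by (simp add: field_simps)
  qed
qed

end

section \<open>Reduction of the three conditions to the perturbation lemmas\<close>

theorem proposition4p4:
  fixes scale :: "'k::conj_normed_field \<Rightarrow> 'v::banach \<Rightarrow> 'v"
    and ip :: "'v \<Rightarrow> 'v \<Rightarrow> 'k"
    and x y :: "nat \<Rightarrow> 'v"
    and A :: real
  assumes "hilbert_space scale ip"
    and "separable_space (euclidean :: 'v topology)"
    and "frame_normalizable ip x"
    and "0 < A"
    and "lower_frame_bound ip (\<lambda>n. x n /\<^sub>R norm (x n)) A"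
    and "\<forall>n. y n \<noteq> 0"
    and "(\<exists>l\<in>{0..<1::real}. \<exists>m\<in>{0..<1::real}. \<forall>N. \<forall>c :: nat \<Rightarrow> 'k.
            norm (\<Sum>n<N. scale (c n) (x n - y n))
              \<le> l * norm (\<Sum>n<N. scale (c n) (x n)) + m * norm (\<Sum>n<N. scale (c n) (y n)))
       \<or> (\<exists>K::real. 0 \<le> K \<and> K < min 1 (sqrt A) \<and> (\<forall>N. \<forall>c :: nat \<Rightarrow> 'k.
            norm (\<Sum>n<N. scale (c n / of_real (norm (x n))) (x n - y n))
              \<le> K * sqrt (\<Sum>n<N. (norm (c n))\<^sup>2)))
       \<or> (\<exists>K::real. 0 \<le> K \<and> K < sqrt A / (1 + sqrt A) \<and> (\<forall>N. \<forall>c :: nat \<Rightarrow> 'k.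
            norm (\<Sum>n<N. scale (c n / of_real (norm (y n))) (x n - y n))
              \<le> K * sqrt (\<Sum>n<N. (norm (c n))\<^sup>2)))"
  shows "frame_normalizable ip y"
proof -
  interpret hilbert_space scale ip by (rule assms(1))
  define f where "f = (\<lambda>n. x n /\<^sub>R norm (x n))"
  have x0: "x n \<noteq> 0" and y0: "y n \<noteq> 0" for n
    using assms(3,6) by (auto simp: frame_normalizable_def)
  obtain B where fr: "frame_bounds ip f A B"
    using assms(5) by (auto simp: lower_frame_bound_def f_def)
  have "is_frame ip (\<lambda>n. y n /\<^sub>R norm (y n))"
    using assms(7)
  proof (elim disjE bexE exE conjE)
    fix l m :: real
    assume lm: "l \<in> {0..<1}" "m \<in> {0..<1}"
      and *: "\<forall>N. \<forall>c :: nat \<Rightarrow> 'k. norm (\<Sum>n<N. scale (c n) (x n - y n))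
        \<le> l * norm (\<Sum>n<N. scale (c n) (x n)) + m * norm (\<Sum>n<N. scale (c n) (y n))"
    define q where "q = max l m"
    have q: "0 \<le> q" "q < 1" "l \<le> q" "m \<le> q" using lm by (auto simp: q_def)
    have **: "norm (\<Sum>n<N. scale (c n) (x n - y n))
        \<le> q * (norm (\<Sum>n<N. scale (c n) (x n)) + norm (\<Sum>n<N. scale (c n) (y n)))" for N c
      unfolding distrib_left
      by (rule order_trans[OF *[rule_format]]) (intro add_mono mult_right_mono q norm_ge_zero)
    \<comment> \<open>The coefficients in (a) are arbitrary, so the condition is unchanged when
      \<open>x n\<close> and \<open>y n\<close> are divided by the same
      \<open>norm (x n)\<close>.\<close>
    have "is_frame ip (\<lambda>n. y n /\<^sub>R norm (x n))"
    proof (rule frame_perturb_synthesis[OF _ q(1,2)])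
      show "is_frame ip f" using fr by (auto simp: is_frame_def)
      show "norm (\<Sum>n<N. scale (c n) (f n - y n /\<^sub>R norm (x n)))
        \<le> q * (norm (\<Sum>n<N. scale (c n) (f n)) + norm (\<Sum>n<N. scale (c n) (y n /\<^sub>R norm (x n))))"
        for N c
        using **[where c = "\<lambda>n. c n / of_real (norm (x n))"]
        by (simp add: scale_divide_of_real f_def scaleR_diff_right)
    qed
    \<comment> \<open>A single coefficient 1 at position \<open>n\<close> gives the estimate
      termwise. This makes \<open>norm (x n)\<close> and \<open>norm (y n)\<close> comparable, as
      renormalization requires.\<close>
    moreover have n: "norm (x n - y n) \<le> q * (norm (x n) + norm (y n))" for n
    proof -
      have pick: "(\<Sum>i<Suc n. scale (if i = n then 1 else 0) (v i)) = v n" for v :: "nat \<Rightarrow> 'v"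
      proof -
        have "(\<Sum>i<Suc n. scale (if i = n then 1 else 0) (v i)) = (\<Sum>i<Suc n. if i = n then v i else 0)"
          by (rule sum.cong) auto
        then show ?thesis by simp
      qed
      show ?thesis
        using **[where N = "Suc n" and c = "\<lambda>i. if i = n then 1 else 0"] by (simp only: pick)
    qed
    have "(1 - q) * norm (y n) \<le> (1 + q) * norm (x n)" for n
      using n[of n] norm_triangle_ineq2[of "y n" "x n"]
      by (simp add: algebra_simps norm_minus_commute)
    then have "(1 - q) / (1 + q) * norm (y n) \<le> norm (x n)" for n
      using q by (simp add: field_simps)
    moreover have "(1 - q) * norm (x n) \<le> (1 + q) * norm (y n)" for n
      using n[of n] norm_triangle_ineq2[of "x n" "y n"] by (simp add: algebra_simps)
    then have "norm (x n) \<le> (1 + q) / (1 - q) * norm (y n)" for n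
      using q by (simp add: field_simps)
    ultimately show ?thesis
      using q x0 y0
      by (intro is_frame_renormalize[where s = "\<lambda>n. norm (x n)" and a = "(1 - q) / (1 + q)"
            and b = "(1 + q) / (1 - q)"]) auto
  next
    fix K :: real
    assume K: "0 \<le> K" "K < min 1 (sqrt A)"
      and *: "\<forall>N. \<forall>c :: nat \<Rightarrow> 'k. norm (\<Sum>n<N. scale (c n / of_real (norm (x n))) (x n - y n))
        \<le> K * sqrt (\<Sum>n<N. (norm (c n))\<^sup>2)"
    \<comment> \<open>Here \<open>K < sqrt A\<close> preserves the lower frame inequality, while
      \<open>K < 1\<close> keeps \<open>norm (y n) / norm (x n)\<close> away from 0.\<close>
    have bs: "bessel (\<lambda>n. f n - y n /\<^sub>R norm (x n)) K"
      using K * by (simp add: bessel_def L2_set_def scale_divide_of_real f_def scaleR_diff_right)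
    have "is_frame ip (\<lambda>n. y n /\<^sub>R norm (x n))"
      by (rule frame_perturb_analysis[OF fr _ bs]) (use K in simp)
    moreover have n: "norm (x n - y n) \<le> K * norm (x n)" for n
    proof -
      have "norm ((x n - y n) /\<^sub>R norm (x n)) \<le> K"
        using bessel_norm_le[OF bs, of n] by (simp add: f_def scaleR_diff_right)
      then have "norm (x n - y n) / norm (x n) \<le> K"
        by (simp add: divide_inverse mult.commute)
      then show ?thesis using x0[of n] by (simp add: field_simps)
    qed
    have "norm (y n) \<le> (1 + K) * norm (x n)" for n
      using n[of n] norm_triangle_ineq2[of "y n" "x n"]
      by (simp add: algebra_simps norm_minus_commute)
    then have "1 / (1 + K) * norm (y n) \<le> norm (x n)" for n
      using K by (simp add: field_simps)
    moreover have "(1 - K) * norm (x n) \<le> norm (y n)" for n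
      using n[of n] norm_triangle_ineq2[of "x n" "y n"] by (simp add: algebra_simps)
    then have "norm (x n) \<le> 1 / (1 - K) * norm (y n)" for n
      using K by (simp add: field_simps)
    ultimately show ?thesis
      using K x0 y0
      by (intro is_frame_renormalize[where s = "\<lambda>n. norm (x n)" and a = "1 / (1 + K)"
            and b = "1 / (1 - K)"]) auto
  next
    fix K :: real
    assume K: "0 \<le> K" "K < sqrt A / (1 + sqrt A)"
      and *: "\<forall>N. \<forall>c :: nat \<Rightarrow> 'k. norm (\<Sum>n<N. scale (c n / of_real (norm (y n))) (x n - y n))
        \<le> K * sqrt (\<Sum>n<N. (norm (c n))\<^sup>2)"
    \<comment> \<open>Under (c) the rescaling comes first: \<open>y n\<close> over its own norm is
      compared with \<open>x n\<close> over the norm of \<open>y n\<close>, a rescaled frame with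
      lower bound \<open>(1 - K)\<^sup>2 * A\<close>.\<close>
    define p where "p = (\<lambda>n. (norm (x n) / norm (y n)) *\<^sub>R f n)"
    have p: "p n = x n /\<^sub>R norm (y n)" for n
      using x0[of n] by (simp add: p_def f_def divide_inverse)
    have sA: "0 < sqrt A" using assms(4) by simp
    \<comment> \<open>The hypothesis on \<open>K\<close> is equivalent to
      \<open>K < (1 - K) * sqrt A\<close>, the smallness needed relative to the lower bound of
      \<open>p\<close>.\<close>
    have "K * (1 + sqrt A) < sqrt A"
      using K(2) sA by (simp add: pos_less_divide_eq)
    then have K': "K < (1 - K) * sqrt A" by (simp add: algebra_simps)
    have "sqrt A / (1 + sqrt A) < 1"
      using sA by (intro divide_less_eq_1_pos[THEN iffD2]) linarith+
    then have K1: "K < 1" using K(2) by linarith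
    have bs: "bessel (\<lambda>n. p n - y n /\<^sub>R norm (y n)) K"
      using K(1) * by (simp add: bessel_def L2_set_def scale_divide_of_real p scaleR_diff_right)
    have n: "norm (x n - y n) \<le> K * norm (y n)" for n
    proof -
      have "norm ((x n - y n) /\<^sub>R norm (y n)) \<le> K"
        using bessel_norm_le[OF bs, of n] by (simp add: p scaleR_diff_right)
      then have "norm (x n - y n) / norm (y n) \<le> K"
        by (simp add: divide_inverse mult.commute)
      then show ?thesis using y0[of n] by (simp add: field_simps)
    qed
    have "1 - K \<le> norm (x n) / norm (y n)" for n
      using n[of n] norm_triangle_ineq2[of "y n" "x n"] y0[of n]
      by (simp add: field_simps norm_minus_commute)
    moreover have "norm (x n) / norm (y n) \<le> 1 + K" for n
      using n[of n] norm_triangle_ineq2[of "x n" "y n"] y0[of n] by (simp add: field_simps)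
    ultimately have "frame_bounds ip p ((1 - K)\<^sup>2 * A) ((1 + K)\<^sup>2 * B)"
      unfolding p_def using K1 by (intro frame_bounds_rescale[OF fr]) auto
    then show ?thesis
      by (rule frame_perturb_analysis[OF _ _ bs]) (use K' K1 in \<open>simp add: real_sqrt_mult\<close>)
  qed
  then show ?thesis using y0 by (simp add: frame_normalizable_def)
qed

end
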